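(* Let $\mathfrak g$ be the Lie algebra of a Lie group $G$. Define on $\mathfrak g^*\times\mathbb R$ (with $z$ the coordinate on $\mathbb R$) the bivector field $\Lambda$ by $$\Lambda(\mu,z)(df,dg)=\left\langle\mu,\left[\frac{\delta f}{\delta\mu},\frac{\delta g}{\delta\mu}\right]\right\rangle+\left\langle\mu,\frac{\delta f}{\delta\mu}\right\rangle\frac{\partial g}{\partial z}-\left\langle\mu,\frac{\delta g}{\delta\mu}\right\rangle\frac{\partial f}{\partial z},\qquad f,g\in C^\infty(\mathfrak g^*\times\mathbb R),$$ and the vector field $E=-\frac{\partial}{\partial z}$. Then $(\Lambda,E)$ is a Jacobi structure on $\mathfrak g^*\times\mathbb R$, and it induces a Jacobi bracket given by $$\{f,g\}(\mu,z)=\Lambda(\mu,z)(df,dg)-f\frac{\partial g}{\partial z}+g\frac{\partial f}{\partial z}.$$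
   Context: $\frac{\delta f}{\delta\mu}(\mu,z)\in\mathfrak g^{**}\cong\mathfrak g$ is the partial derivative of $f$ with respect to $\mu\in\mathfrak g^*$. A Jacobi structure on a manifold $M$ is a pair $(\Lambda,E)$ of a bivector field and a vector field with $[\Lambda,\Lambda]=2E\wedge\Lambda$ and $[E,\Lambda]=0$, where $[\cdot,\cdot]$ is the Schouten-Nijenhuis bracket (with the sign convention for which these conditions are equivalent to the Jacobi identity of the bracket below). A Jacobi bracket on $M$ is a bilinear, skew-symmetric map $\{\cdot,\cdot\}:C^\infty(M)\times C^\infty(M)\to C^\infty(M)$ satisfying the Jacobi identity and $\operatorname{supp}\{f,g\}\subseteq\operatorname{supp}f\cap\operatorname{supp}g$. The Jacobi bracket induced by $(\Lambda,E)$ is $\{f,g\}=\Lambda(df,dg)+fE(g)-gE(f)$. *)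

theory Defs
  imports "HOL-Analysis.Analysis" "HOL-Combinatorics.Permutations" "HOL-Algebra.Group"
begin

(* Vector spaces are normed spaces with an explicit finite-dimensionality hypothesis rather than
   members of class euclidean_space: euclidean_space excludes dimension 0. All norms on a
   finite-dimensional space are equivalent, so the norm serves only to give access to the library's
   derivatives, and the bounded functionals form the full linear dual. *)
definition fin_dim :: "'a::real_vector set \<Rightarrow> bool" where
  "fin_dim V \<longleftrightarrow> (\<exists>B. finite B \<and> span B = V)"

type_synonym 'v dual = "'v \<Rightarrow>\<^sub>L real"


section \<open>Smooth functions\<close>

(* f is C^n on the open set S. In finite dimension this is the usual notion: f is C^(n+1) iff it is
   differentiable with all its directional derivatives of class C^n. *)
primrec Ck_on :: "nat \<Rightarrow> 'a::real_normed_vector set \<Rightarrow> ('a \<Rightarrow> 'b::real_normed_vector) \<Rightarrow> bool" where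
  "Ck_on 0 S f \<longleftrightarrow> continuous_on S f"
| "Ck_on (Suc n) S f \<longleftrightarrow>
     (\<forall>x\<in>S. f differentiable (at x)) \<and> (\<forall>v. Ck_on n S (\<lambda>x. frechet_derivative f (at x) v))"

definition smooth_on :: "'a::real_normed_vector set \<Rightarrow> ('a \<Rightarrow> 'b::real_normed_vector) \<Rightarrow> bool" where
  "smooth_on S f \<longleftrightarrow> (\<forall>n. Ck_on n S f)"

abbreviation smooth :: "('a::real_normed_vector \<Rightarrow> 'b::real_normed_vector) \<Rightarrow> bool" where
  "smooth f \<equiv> smooth_on UNIV f"

definition differential :: "('v::real_normed_vector \<Rightarrow> real) \<Rightarrow> 'v \<Rightarrow> 'v dual" where
  "differential f x = Blinfun (frechet_derivative f (at x))"


section \<open>Lie groups and their Lie algebras\<close>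

(* A chart is a pair (U, phi) of a domain and a coordinate map into the model space 'e. *)
definition smooth_atlas :: "('a::topological_space set \<times> ('a \<Rightarrow> 'e::real_normed_vector)) set \<Rightarrow> bool" where
  "smooth_atlas A \<longleftrightarrow>
     (\<forall>(U, \<phi>)\<in>A. open U \<and> open (\<phi> ` U) \<and> homeomorphism U (\<phi> ` U) \<phi> (inv_into U \<phi>)) \<and>
     (\<Union>(U, \<phi>)\<in>A. U) = UNIV \<and>
     (\<forall>(U, \<phi>)\<in>A. \<forall>(V, \<psi>)\<in>A. smooth_on (\<phi> ` (U \<inter> V)) (\<psi> \<circ> inv_into U \<phi>))"

definition smooth_functions ::
    "('a set \<times> ('a \<Rightarrow> 'e::real_normed_vector)) set \<Rightarrow> ('a \<Rightarrow> real) set" where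
  "smooth_functions A = {f. \<forall>(U, \<phi>)\<in>A. smooth_on (\<phi> ` U) (f \<circ> inv_into U \<phi>)}"

(* The manifold is the whole (Hausdorff, second countable) type 'a. *)
definition lie_group ::
    "('a::{t2_space,second_countable_topology}) monoid
       \<Rightarrow> ('a set \<times> ('a \<Rightarrow> 'e::real_normed_vector)) set \<Rightarrow> bool" where
  "lie_group G A \<longleftrightarrow>
     fin_dim (UNIV :: 'e set) \<and> smooth_atlas A \<and> group G \<and> carrier G = UNIV \<and>
     continuous_on UNIV (\<lambda>(g, h). g \<otimes>\<^bsub>G\<^esub> h) \<and>
     (\<forall>(U, \<phi>)\<in>A. \<forall>(V, \<psi>)\<in>A. \<forall>(W, \<theta>)\<in>A.
        smooth_on {(\<phi> g, \<psi> h) | g h. g \<in> U \<and> h \<in> V \<and> g \<otimes>\<^bsub>G\<^esub> h \<in> W}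
          (\<lambda>(x, y). \<theta> (inv_into U \<phi> x \<otimes>\<^bsub>G\<^esub> inv_into V \<psi> y))) \<and>
     continuous_on UNIV (\<lambda>g. inv\<^bsub>G\<^esub> g) \<and>
     (\<forall>(U, \<phi>)\<in>A. \<forall>(W, \<theta>)\<in>A.
        smooth_on {\<phi> g | g. g \<in> U \<and> inv\<^bsub>G\<^esub> g \<in> W} (\<lambda>x. \<theta> (inv\<^bsub>G\<^esub> (inv_into U \<phi> x))))"

(* Left-invariant vector fields, as derivations of the algebra of smooth functions. A derivation is
   a total HOL function, so its values off the smooth functions are set to 0; without this, distinct
   HOL functions would represent the same vector field. *)
definition left_invariant_fields ::
    "'a monoid \<Rightarrow> ('a set \<times> ('a \<Rightarrow> 'e::real_normed_vector)) set
       \<Rightarrow> (('a \<Rightarrow> real) \<Rightarrow> ('a \<Rightarrow> real)) set" where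
  "left_invariant_fields G A = {X.
     (\<forall>f. f \<notin> smooth_functions A \<longrightarrow> X f = (\<lambda>_. 0)) \<and>
     (\<forall>f\<in>smooth_functions A. X f \<in> smooth_functions A) \<and>
     (\<forall>f\<in>smooth_functions A. \<forall>h\<in>smooth_functions A. \<forall>a b.
        X (\<lambda>p. a * f p + b * h p) = (\<lambda>p. a * X f p + b * X h p)) \<and>
     (\<forall>f\<in>smooth_functions A. \<forall>h\<in>smooth_functions A.
        X (\<lambda>p. f p * h p) = (\<lambda>p. X f p * h p + f p * X h p)) \<and>
     (\<forall>f\<in>smooth_functions A. \<forall>g. X (\<lambda>p. f (g \<otimes>\<^bsub>G\<^esub> p)) = (\<lambda>p. X f (g \<otimes>\<^bsub>G\<^esub> p)))}"

(* The vector space 'g with the bracket br is the Lie algebra of G: \<iota> identifies it with the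
   left-invariant vector fields under the commutator. *)
definition is_lie_algebra_of ::
    "('g::real_vector \<Rightarrow> 'g \<Rightarrow> 'g) \<Rightarrow> 'a monoid
       \<Rightarrow> ('a set \<times> ('a \<Rightarrow> 'e::real_normed_vector)) set \<Rightarrow> bool" where
  "is_lie_algebra_of br G A \<longleftrightarrow> (\<exists>\<iota>.
     bij_betw \<iota> UNIV (left_invariant_fields G A) \<and>
     (\<forall>a b \<xi> \<eta> f p. \<iota> (a *\<^sub>R \<xi> + b *\<^sub>R \<eta>) f p = a * \<iota> \<xi> f p + b * \<iota> \<eta> f p) \<and>
     (\<forall>\<xi> \<eta> f p. f \<in> smooth_functions A \<longrightarrow>
        \<iota> (br \<xi> \<eta>) f p = \<iota> \<xi> (\<iota> \<eta> f) p - \<iota> \<eta> (\<iota> \<xi> f) p))"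


section \<open>Multivector fields and Jacobi structures on a vector space\<close>

definition vector_field :: "('v::real_normed_vector \<Rightarrow> 'v) \<Rightarrow> bool" where
  "vector_field E \<longleftrightarrow> smooth E"

definition bivector_field :: "('v::real_normed_vector \<Rightarrow> 'v dual \<Rightarrow> 'v dual \<Rightarrow> real) \<Rightarrow> bool" where
  "bivector_field \<Lambda> \<longleftrightarrow>
     (\<forall>x. bilinear (\<Lambda> x)) \<and> (\<forall>x \<alpha> \<beta>. \<Lambda> x \<alpha> \<beta> = - \<Lambda> x \<beta> \<alpha>) \<and>
     (\<forall>\<alpha> \<beta>. smooth (\<lambda>x. \<Lambda> x \<alpha> \<beta>))"

(* A p-vector field takes a point and a sequence of covectors, of which only the first p matter. *)
type_synonym 'v multivector_field = "'v \<Rightarrow> (nat \<Rightarrow> 'v dual) \<Rightarrow> real"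

definition of_vector :: "('v::real_normed_vector \<Rightarrow> 'v) \<Rightarrow> 'v multivector_field" where
  "of_vector E = (\<lambda>x \<alpha>. blinfun_apply (\<alpha> 0) (E x))"

definition of_bivector ::
    "('v::real_normed_vector \<Rightarrow> 'v dual \<Rightarrow> 'v dual \<Rightarrow> real) \<Rightarrow> 'v multivector_field" where
  "of_bivector \<Lambda> = (\<lambda>x \<alpha>. \<Lambda> x (\<alpha> 0) (\<alpha> 1))"

(* Normalised so that (E \<and> \<Lambda>)(\<alpha>,\<beta>,\<gamma>) = \<alpha>(E) \<Lambda>(\<beta>,\<gamma>) + \<beta>(E) \<Lambda>(\<gamma>,\<alpha>) + \<gamma>(E) \<Lambda>(\<alpha>,\<beta>). *)
definition wedge ::
    "nat \<Rightarrow> nat \<Rightarrow> 'v::real_normed_vector multivector_field \<Rightarrow> 'v multivector_field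
       \<Rightarrow> 'v multivector_field" where
  "wedge p q P Q = (\<lambda>x \<alpha>. 1 / (fact p * fact q) *
     (\<Sum>\<sigma> | \<sigma> permutes {..<p + q}.
        of_int (sign \<sigma>) * P x (\<lambda>i. \<alpha> (\<sigma> i)) * Q x (\<lambda>i. \<alpha> (\<sigma> (p + i)))))"

(* For a p-vector field P and a q-vector field Q, the skew-symmetrisation of
     (f_1, ..., f_(p+q-1)) \<mapsto> P (d (Q (df_1, ..., df_q)), df_(q+1), ..., df_(p+q-1)),
   evaluated on the linear functions f_i = \<alpha>_i, whose differentials are the constant forms \<alpha>_i. *)
definition mv_comp ::
    "nat \<Rightarrow> nat \<Rightarrow> 'v::real_normed_vector multivector_field \<Rightarrow> 'v multivector_field
       \<Rightarrow> 'v multivector_field" where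
  "mv_comp p q P Q = (\<lambda>x \<alpha>. 1 / (fact q * fact (p - 1)) *
     (\<Sum>\<sigma> | \<sigma> permutes {..<p + q - 1}.
        of_int (sign \<sigma>) *
        P x (case_nat (differential (\<lambda>y. Q y (\<lambda>i. \<alpha> (\<sigma> i))) x) (\<lambda>i. \<alpha> (\<sigma> (q + i))))))"

(* The Schouten-Nijenhuis bracket of multivector fields of degrees p, q \<ge> 1. The second-order terms
   of the two compositions cancel, so the bracket is a tensor and is determined by its values on
   linear functions. On vector fields it is the Lie bracket, for a vector field E and a bivector
   field \<Lambda> it is the Lie derivative of \<Lambda> along E, and
   [\<Lambda>,\<Lambda>](df,dg,dh) = 2 (\<Lambda>(d(\<Lambda>(df,dg)),dh) + cyclic). This is the sign for which
   [\<Lambda>,\<Lambda>] = 2 E \<and> \<Lambda> and [E,\<Lambda>] = 0 are together equivalent to the Jacobi identity of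
   \<Lambda>(df,dg) + f E(g) - g E(f). *)
definition schouten ::
    "nat \<Rightarrow> nat \<Rightarrow> 'v::real_normed_vector multivector_field \<Rightarrow> 'v multivector_field
       \<Rightarrow> 'v multivector_field" where
  "schouten p q P Q =
     (\<lambda>x \<alpha>. mv_comp p q P Q x \<alpha> - (- 1) ^ ((p - 1) * (q - 1)) * mv_comp q p Q P x \<alpha>)"

definition jacobi_structure ::
    "('v::real_normed_vector \<Rightarrow> 'v dual \<Rightarrow> 'v dual \<Rightarrow> real) \<Rightarrow> ('v \<Rightarrow> 'v) \<Rightarrow> bool" where
  "jacobi_structure \<Lambda> E \<longleftrightarrow>
     bivector_field \<Lambda> \<and> vector_field E \<and>
     schouten 2 2 (of_bivector \<Lambda>) (of_bivector \<Lambda>) =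
       (\<lambda>x \<alpha>. 2 * wedge 1 2 (of_vector E) (of_bivector \<Lambda>) x \<alpha>) \<and>
     schouten 1 2 (of_vector E) (of_bivector \<Lambda>) = (\<lambda>x \<alpha>. 0)"

definition supp :: "('v::real_normed_vector \<Rightarrow> real) \<Rightarrow> 'v set" where
  "supp f = closure (support_on UNIV f)"

definition jacobi_bracket ::
    "(('v::real_normed_vector \<Rightarrow> real) \<Rightarrow> ('v \<Rightarrow> real) \<Rightarrow> 'v \<Rightarrow> real) \<Rightarrow> bool" where
  "jacobi_bracket B \<longleftrightarrow>
     (\<forall>f g. smooth f \<longrightarrow> smooth g \<longrightarrow> smooth (B f g)) \<and>
     (\<forall>a b f g h. smooth f \<longrightarrow> smooth g \<longrightarrow> smooth h \<longrightarrow>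
        B (\<lambda>x. a * f x + b * g x) h = (\<lambda>x. a * B f h x + b * B g h x) \<and>
        B h (\<lambda>x. a * f x + b * g x) = (\<lambda>x. a * B h f x + b * B h g x)) \<and>
     (\<forall>f g. smooth f \<longrightarrow> smooth g \<longrightarrow> B f g = (\<lambda>x. - B g f x)) \<and>
     (\<forall>f g h. smooth f \<longrightarrow> smooth g \<longrightarrow> smooth h \<longrightarrow>
        (\<forall>x. B (B f g) h x + B (B g h) f x + B (B h f) g x = 0)) \<and>
     (\<forall>f g. smooth f \<longrightarrow> smooth g \<longrightarrow> supp (B f g) \<subseteq> supp f \<inter> supp g)"

definition induced_bracket ::
    "('v::real_normed_vector \<Rightarrow> 'v dual \<Rightarrow> 'v dual \<Rightarrow> real) \<Rightarrow> ('v \<Rightarrow> 'v)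
       \<Rightarrow> ('v \<Rightarrow> real) \<Rightarrow> ('v \<Rightarrow> real) \<Rightarrow> 'v \<Rightarrow> real" where
  "induced_bracket \<Lambda> E f g x =
     \<Lambda> x (differential f x) (differential g x)
     + f x * blinfun_apply (differential g x) (E x) - g x * blinfun_apply (differential f x) (E x)"


section \<open>The Jacobi structure on the product of the dual and the real line\<close>

(* The derivative of f in \<mu> is an element of the bidual; partial_mu is the element of 'g whose
   evaluation functional it is. *)
definition partial_mu ::
    "('g::real_normed_vector dual \<times> real \<Rightarrow> real) \<Rightarrow> 'g dual \<Rightarrow> real \<Rightarrow> 'g" where
  "partial_mu f \<mu> z = (THE \<xi>. \<forall>\<nu>::'g dual.
     frechet_derivative (\<lambda>\<mu>'. f (\<mu>', z)) (at \<mu>) \<nu> = blinfun_apply \<nu> \<xi>)"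

definition partial_z ::
    "('g::real_normed_vector dual \<times> real \<Rightarrow> real) \<Rightarrow> 'g dual \<Rightarrow> real \<Rightarrow> real" where
  "partial_z f \<mu> z = deriv (\<lambda>t. f (\<mu>, t)) z"

(* A covector \<alpha> on the vector space is the differential, at every point, of \<alpha> itself seen as a linear
   function; the formula for \<Lambda>(df,dg) at f = \<alpha>, g = \<beta> therefore gives \<Lambda>(\<alpha>,\<beta>). *)
definition lie_Lambda ::
    "('g::real_normed_vector \<Rightarrow> 'g \<Rightarrow> 'g) \<Rightarrow> 'g dual \<times> real
       \<Rightarrow> ('g dual \<times> real) dual \<Rightarrow> ('g dual \<times> real) dual \<Rightarrow> real" where
  "lie_Lambda br = (\<lambda>(\<mu>, z) \<alpha> \<beta>.
     let f = blinfun_apply \<alpha>; g = blinfun_apply \<beta> in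
       blinfun_apply \<mu> (br (partial_mu f \<mu> z) (partial_mu g \<mu> z))
       + blinfun_apply \<mu> (partial_mu f \<mu> z) * partial_z g \<mu> z
       - blinfun_apply \<mu> (partial_mu g \<mu> z) * partial_z f \<mu> z)"

definition lie_E :: "'g::real_normed_vector dual \<times> real \<Rightarrow> 'g dual \<times> real" where
  "lie_E = (\<lambda>(\<mu>, z). (0, - 1))"

end

theory Submission
  imports Defs
begin

text \<open>A dual basis of \<open>\<gg>\<close> turns \<open>\<delta>f/\<delta>\<mu>\<close> into a finite sum of directional derivatives. On constant
  covectors \<open>\<Lambda>\<close> is linear in \<open>\<mu>\<close> and independent of \<open>z\<close>, so both Schouten identities reduce to
  the Jacobi identity of \<open>\<gg>\<close>. For the bracket, put
  \<open>X\<^sub>h = (\<langle>\<mu>, [\<cdot>, \<delta>h/\<delta>\<mu>]\<rangle> + h\<^sub>z \<mu>, h - \<langle>\<mu>, \<delta>h/\<delta>\<mu>\<rangle>)\<close>; then \<open>{k, h} = dk(X\<^sub>h) - k h\<^sub>z\<close>, and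
  \<open>d{f, g}(v) = \<langle>\<nu>, [\<delta>f/\<delta>\<mu>, \<delta>g/\<delta>\<mu>]\<rangle> + D\<^sup>2f(v, X\<^sub>g) - D\<^sup>2g(v, X\<^sub>f)\<close> for \<open>v = (\<nu>, s)\<close>. In the
  cyclic sum of \<open>{{f, g}, h}\<close> the second derivatives cancel by symmetry, and what remains is the
  Jacobi identity of \<open>\<gg>\<close> paired with \<open>\<mu>\<close>.\<close>

section \<open>Smooth functions\<close>

abbreviation D :: "('a::real_normed_vector \<Rightarrow> 'b::real_normed_vector) \<Rightarrow> 'a \<Rightarrow> 'a \<Rightarrow> 'b" where
  "D f x \<equiv> frechet_derivative f (at x)"

lemma D_eqI: "(f has_derivative f') (at x) \<Longrightarrow> D f x = f'"
  by (metis frechet_derivative_at)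

lemma smooth_differentiable: "smooth f \<Longrightarrow> f differentiable (at x)"
  unfolding smooth_on_def by (metis Ck_on.simps(2) UNIV_I)

lemma smooth_has_derivative: "smooth f \<Longrightarrow> (f has_derivative D f x) (at x)"
  using smooth_differentiable frechet_derivative_works by blast

lemma smooth_continuous: "smooth f \<Longrightarrow> continuous_on UNIV f"
  unfolding smooth_on_def by (metis Ck_on.simps(1))

lemma smooth_D: "smooth f \<Longrightarrow> smooth (\<lambda>x. D f x v)"
  unfolding smooth_on_def by (metis Ck_on.simps(2))

text \<open>Induction on the order: membership in \<open>F\<close> gives differentiability, hence
  continuity, and passes to every directional derivative. A smoothness proof becomes the search for
  a class stable under differentiation.\<close>

lemma smooth_coinduct:
  assumes "f \<in> F" "\<And>f x. f \<in> F \<Longrightarrow> f differentiable (at x)"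
    "\<And>f v. f \<in> F \<Longrightarrow> (\<lambda>x. D f x v) \<in> F"
  shows "smooth f"
proof -
  have "Ck_on n UNIV f" if "f \<in> F" for n f
    using that
  proof (induction n arbitrary: f)
    case 0
    then show ?case
      by (simp add: assms(2) continuous_at_imp_continuous_on differentiable_imp_continuous_within)
  next
    case (Suc n)
    then show ?case using assms(2,3) by simp
  qed
  then show ?thesis using assms(1) unfolding smooth_on_def by blast
qed

lemma smooth_const: "smooth (\<lambda>x. c)"
proof (rule smooth_coinduct)
  show "(\<lambda>x. c) \<in> {\<lambda>x. c | c. True}" by blast
qed force+

lemma smooth_bounded_linear:
  assumes "bounded_linear f" shows "smooth f"
proof (rule smooth_coinduct)
  have f: "D f x = f" "f differentiable (at x)" for x
    using bounded_linear_imp_has_derivative[OF assms] by (blast intro: D_eqI differentiableI)+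
  \<comment> \<open>Differentiating \<open>f\<close> once gives a constant, so joining the single
    function \<open>f\<close> to the smooth functions already gives a stable class.\<close>
  show "f \<in> insert f {g. smooth g}" by simp
  show "g differentiable (at x)" if "g \<in> insert f {g. smooth g}" for g x
    using that f(2) smooth_differentiable by blast
  show "(\<lambda>x. D g x v) \<in> insert f {g. smooth g}" if "g \<in> insert f {g. smooth g}" for g v
    using that by (cases "g = f") (simp_all add: f(1) smooth_const smooth_D)
qed

text \<open>The product rule turns a product into a sum of products, so a class stable under
  differentiation needs closure under both operations at once.\<close>

inductive_set smooth_algebra :: "('a::real_normed_vector \<Rightarrow> real) set" where
  base: "smooth f \<Longrightarrow> f \<in> smooth_algebra"
| add: "f \<in> smooth_algebra \<Longrightarrow> g \<in> smooth_algebra \<Longrightarrow> (\<lambda>x. f x + g x) \<in> smooth_algebra"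
| mult: "f \<in> smooth_algebra \<Longrightarrow> g \<in> smooth_algebra \<Longrightarrow> (\<lambda>x. f x * g x) \<in> smooth_algebra"

lemma smooth_algebra_smooth:
  assumes "f \<in> smooth_algebra" shows "smooth f"
proof (rule smooth_coinduct[where F = smooth_algebra, OF assms])
  have "(\<forall>x. f differentiable (at x)) \<and> (\<forall>v. (\<lambda>x. D f x v) \<in> smooth_algebra)"
    if "f \<in> smooth_algebra" for f :: "'a \<Rightarrow> real"
    using that
  proof induction
    case (base f)
    then show ?case by (auto intro: smooth_differentiable smooth_D smooth_algebra.base)
  next
    case (add f g)
    have "D (\<lambda>x. f x + g x) x = (\<lambda>v. D f x v + D g x v)" for x
      by (rule D_eqI, rule has_derivative_add) (use add in \<open>simp_all add: frechet_derivative_works[symmetric]\<close>)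
    with add show ?case by (auto intro: smooth_algebra.intros)
  next
    case (mult f g)
    have "D (\<lambda>x. f x * g x) x = (\<lambda>v. f x * D g x v + D f x v * g x)" for x
      by (rule D_eqI, rule has_derivative_mult) (use mult in \<open>simp_all add: frechet_derivative_works[symmetric]\<close>)
    then show ?case
      using mult smooth_algebra.add[OF smooth_algebra.mult[of f "\<lambda>x. D g x v" for v]
          smooth_algebra.mult[of "\<lambda>x. D f x v" g for v]]
      by (simp add: differentiable_mult)
  qed
  then show "f differentiable (at x)" "(\<lambda>x. D f x v) \<in> smooth_algebra"
    if "f \<in> smooth_algebra" for f :: "'a \<Rightarrow> real" and x v
    using that by auto
qed

lemma smooth_add:
  fixes f g :: "'a::real_normed_vector \<Rightarrow> real"
  shows "smooth f \<Longrightarrow> smooth g \<Longrightarrow> smooth (\<lambda>x. f x + g x)"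
  by (intro smooth_algebra_smooth smooth_algebra.add) (simp_all add: smooth_algebra.base)

lemma smooth_mult:
  fixes f g :: "'a::real_normed_vector \<Rightarrow> real"
  shows "smooth f \<Longrightarrow> smooth g \<Longrightarrow> smooth (\<lambda>x. f x * g x)"
  by (intro smooth_algebra_smooth smooth_algebra.mult) (simp_all add: smooth_algebra.base)

lemma smooth_diff:
  fixes f g :: "'a::real_normed_vector \<Rightarrow> real"
  assumes "smooth f" "smooth g" shows "smooth (\<lambda>x. f x - g x)"
  using smooth_add[OF assms(1) smooth_mult[OF smooth_const[of "- 1"] assms(2)]] by simp

lemma smooth_sum:
  fixes f :: "'i \<Rightarrow> 'a::real_normed_vector \<Rightarrow> real"
  assumes "\<And>i. i \<in> I \<Longrightarrow> smooth (f i)" shows "smooth (\<lambda>x. \<Sum>i\<in>I. f i x)"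
  using assms by (induction I rule: infinite_finite_induct) (auto intro: smooth_add smooth_const)

section \<open>Symmetry of second derivatives\<close>

lemma has_real_derivative_along_line:
  fixes f :: "'a::real_normed_vector \<Rightarrow> real"
  assumes "f differentiable (at (x + t *\<^sub>R v))"
  shows "((\<lambda>t. f (x + t *\<^sub>R v)) has_real_derivative D f (x + t *\<^sub>R v) v) (at t)"
proof -
  have "((\<lambda>t. f (x + t *\<^sub>R v)) has_derivative (\<lambda>s. D f (x + t *\<^sub>R v) (s *\<^sub>R v))) (at t)"
    by (rule has_derivative_compose[of "\<lambda>t. x + t *\<^sub>R v"])
      (use assms in \<open>auto intro!: derivative_eq_intros simp: frechet_derivative_works[symmetric]\<close>)
  then show ?thesis
    using linear_frechet_derivative[OF assms]
    by (simp add: has_field_derivative_def linear_scale mult_commute_abs)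
qed

text \<open>A mixed second derivative is a limit of second differences, which are symmetric in the two
  directions.\<close>

lemma second_difference:
  fixes f :: "'a::real_normed_vector \<Rightarrow> real"
  assumes f: "smooth f" and h: "h > 0"
  obtains s t where "0 < s" "s < h" "0 < t" "t < h"
    "f (x + h *\<^sub>R u + h *\<^sub>R v) - f (x + h *\<^sub>R u) - f (x + h *\<^sub>R v) + f x
       = h * h * D (\<lambda>y. D f y u) (x + s *\<^sub>R u + t *\<^sub>R v) v"
proof -
  \<comment> \<open>The mean value theorem is used twice: along \<open>u\<close> for the increment
    of \<open>f\<close> across \<open>h *\<^sub>R v\<close>, then along \<open>v\<close> for the
    directional derivative \<open>\<lambda>y. D f y u\<close>.\<close>
  define \<phi> where "\<phi> r = f ((x + h *\<^sub>R v) + r *\<^sub>R u) - f (x + r *\<^sub>R u)" for r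
  have "(\<phi> has_real_derivative D f ((x + h *\<^sub>R v) + r *\<^sub>R u) u - D f (x + r *\<^sub>R u) u) (at r)" for r
    unfolding \<phi>_def by (intro DERIV_diff has_real_derivative_along_line smooth_differentiable f)
  from MVT2[OF h this] obtain s where s: "0 < s" "s < h"
      "\<phi> h - \<phi> 0 = (h - 0) * (D f ((x + h *\<^sub>R v) + s *\<^sub>R u) u - D f (x + s *\<^sub>R u) u)"
    by blast
  define \<psi> where "\<psi> r = D f ((x + s *\<^sub>R u) + r *\<^sub>R v) u" for r
  have "(\<psi> has_real_derivative D (\<lambda>y. D f y u) ((x + s *\<^sub>R u) + r *\<^sub>R v) v) (at r)" for r
    unfolding \<psi>_def
    by (intro has_real_derivative_along_line[of "\<lambda>y. D f y u"] smooth_differentiable smooth_D f)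
  from MVT2[OF h this] obtain t where t: "0 < t" "t < h"
      "\<psi> h - \<psi> 0 = (h - 0) * D (\<lambda>y. D f y u) ((x + s *\<^sub>R u) + t *\<^sub>R v) v"
    by blast
  have \<phi>: "\<phi> h - \<phi> 0 = f (x + h *\<^sub>R u + h *\<^sub>R v) - f (x + h *\<^sub>R u) - f (x + h *\<^sub>R v) + f x"
    by (simp add: \<phi>_def add.assoc add.commute[of "h *\<^sub>R u"])
  have \<psi>: "\<psi> h - \<psi> 0 = D f ((x + h *\<^sub>R v) + s *\<^sub>R u) u - D f (x + s *\<^sub>R u) u"
    by (simp add: \<psi>_def add.assoc add.commute[of "s *\<^sub>R u"])
  show thesis
    by (rule that[OF s(1,2) t(1,2)]) (use s(3) t(3) in \<open>simp flip: \<phi> \<psi>\<close>)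
qed

text \<open>The intermediate parameters lie between \<open>0\<close> and \<open>h\<close>, so the
  intermediate points tend to \<open>x\<close>, where the mixed derivative is continuous.\<close>

lemma second_difference_tendsto:
  fixes f :: "'a::real_normed_vector \<Rightarrow> real"
  assumes f: "smooth f"
  shows "((\<lambda>h. (f (x + h *\<^sub>R u + h *\<^sub>R v) - f (x + h *\<^sub>R u) - f (x + h *\<^sub>R v) + f x) / (h * h))
    \<longlongrightarrow> D (\<lambda>y. D f y u) x v) (at_right 0)"
proof -
  \<comment> \<open>The guard \<open>0 < h\<close> makes the claim true for every \<open>h\<close>,
    so that \<open>s\<close> and \<open>t\<close> can be chosen as total functions.\<close>
  have "\<exists>s t. 0 < h \<longrightarrow> (0 < s \<and> s < h \<and> 0 < t \<and> t < h \<and>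
    f (x + h *\<^sub>R u + h *\<^sub>R v) - f (x + h *\<^sub>R u) - f (x + h *\<^sub>R v) + f x
       = h * h * D (\<lambda>y. D f y u) (x + s *\<^sub>R u + t *\<^sub>R v) v)" for h
    using second_difference[OF f, of h x u v] by metis
  then obtain s t where st: "\<And>h. 0 < h \<Longrightarrow> 0 < s h \<and> s h < h \<and> 0 < t h \<and> t h < h \<and>
    f (x + h *\<^sub>R u + h *\<^sub>R v) - f (x + h *\<^sub>R u) - f (x + h *\<^sub>R v) + f x
       = h * h * D (\<lambda>y. D f y u) (x + s h *\<^sub>R u + t h *\<^sub>R v) v"
    by metis
  have pos: "\<forall>\<^sub>F h in at_right 0. (0::real) < h" by (rule eventually_at_right_less)
  have id: "((\<lambda>h. h) \<longlongrightarrow> (0::real)) (at_right 0)" by (rule tendsto_ident_at)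
  have small: "(r \<longlongrightarrow> 0) (at_right 0)" if "\<And>h. 0 < h \<Longrightarrow> 0 < r h \<and> r h < h" for r :: "real \<Rightarrow> real"
    by (rule tendsto_sandwich[OF _ _ tendsto_const id])
      (rule eventually_mono[OF pos], use that in \<open>simp add: less_imp_le\<close>)+
  have s0: "(s \<longlongrightarrow> 0) (at_right 0)" and t0: "(t \<longlongrightarrow> 0) (at_right 0)"
    using st by (blast intro: small)+
  have "((\<lambda>h. x + s h *\<^sub>R u + t h *\<^sub>R v) \<longlongrightarrow> x + 0 *\<^sub>R u + 0 *\<^sub>R v) (at_right 0)"
    by (intro tendsto_intros s0 t0)
  moreover have "isCont (\<lambda>y. D (\<lambda>y. D f y u) y v) x"
    using smooth_continuous[OF smooth_D[OF smooth_D[OF f]]]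
    by (simp add: continuous_on_eq_continuous_at)
  ultimately have "((\<lambda>h. D (\<lambda>y. D f y u) (x + s h *\<^sub>R u + t h *\<^sub>R v) v)
      \<longlongrightarrow> D (\<lambda>y. D f y u) x v) (at_right 0)"
    using isCont_tendsto_compose[where g = "\<lambda>y. D (\<lambda>y. D f y u) y v" and l = x] by simp
  then show ?thesis
    by (rule Lim_transform_eventually) (rule eventually_mono[OF pos], simp add: st)
qed

lemma second_derivative_symmetric:
  fixes f :: "'a::real_normed_vector \<Rightarrow> real"
  assumes f: "smooth f"
  shows "D (\<lambda>y. D f y u) x v = D (\<lambda>y. D f y v) x u"
proof (rule tendsto_unique[OF _ second_difference_tendsto[OF f]])
  have "f (x + h *\<^sub>R v + h *\<^sub>R u) - f (x + h *\<^sub>R v) - f (x + h *\<^sub>R u) + f x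
      = f (x + h *\<^sub>R u + h *\<^sub>R v) - f (x + h *\<^sub>R u) - f (x + h *\<^sub>R v) + f x" for h
    unfolding add.assoc[of x] add.commute[of "h *\<^sub>R v" "h *\<^sub>R u"] by linarith
  then show "((\<lambda>h. (f (x + h *\<^sub>R u + h *\<^sub>R v) - f (x + h *\<^sub>R u) - f (x + h *\<^sub>R v) + f x) / (h * h))
    \<longlongrightarrow> D (\<lambda>y. D f y v) x u) (at_right 0)"
    using second_difference_tendsto[OF f, of x v u] by (simp only:)
qed (rule trivial_limit_at_right_real)

section \<open>Dual bases of finite-dimensional normed spaces\<close>

text \<open>This makes coordinate functionals bounded. In the induction, a new vector
  \<open>a\<close> has positive distance from \<open>span B\<close>: otherwise combinations of
  \<open>B\<close> would tend to \<open>- a\<close>, their coefficients would be Cauchy by the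
  induction hypothesis, and the limit would put \<open>a\<close> into the span. That distance
  controls the coefficient of \<open>a\<close>; the triangle inequality controls the others.\<close>

lemma coefficients_bounded:
  fixes B :: "'a::real_normed_vector set"
  assumes "finite B" "independent B"
  shows "\<exists>C\<ge>0. \<forall>c. \<forall>b\<in>B. \<bar>c b\<bar> \<le> C * norm (\<Sum>b\<in>B. c b *\<^sub>R b)"
  using assms
proof (induction B)
  case empty
  then show ?case by (auto intro: exI[of _ 0])
next
  case (insert a B)
  then have indep: "independent B" and a: "a \<notin> span B"
    using independent_insert[of a B] by auto
  then obtain C where C: "C \<ge> 0" "\<And>c b. b \<in> B \<Longrightarrow> \<bar>c b\<bar> \<le> C * norm (\<Sum>b\<in>B. c b *\<^sub>R b)"
    using insert.IH by metis
  have "\<exists>d>0. \<forall>c. d \<le> norm (a + (\<Sum>b\<in>B. c b *\<^sub>R b))"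
  proof (rule ccontr)
    assume "\<not> ?thesis"
    then have "\<forall>n. \<exists>c. norm (a + (\<Sum>b\<in>B. c b *\<^sub>R b)) < inverse (real (Suc n))"
      by (meson inverse_positive_iff_positive not_less of_nat_0_less_iff zero_less_Suc)
    then obtain c where c: "\<And>n. norm (a + (\<Sum>b\<in>B. c n b *\<^sub>R b)) < inverse (real (Suc n))"
      by metis
    let ?s = "\<lambda>n. \<Sum>b\<in>B. c n b *\<^sub>R b"
    have lim: "(\<lambda>n. a + ?s n) \<longlonglongrightarrow> 0"
      by (rule Lim_null_comparison[OF _ LIMSEQ_inverse_real_of_nat])
        (use c in \<open>auto intro!: always_eventually less_imp_le\<close>)
    have s: "?s \<longlonglongrightarrow> - a"
      using tendsto_diff[OF lim tendsto_const[of a]] by simp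
    have "\<exists>l. (\<lambda>n. c n b) \<longlonglongrightarrow> l" if b: "b \<in> B" for b
    proof -
      have "Cauchy (\<lambda>n. c n b)"
        unfolding Cauchy_def
      proof (intro allI impI)
        fix e :: real assume "e > 0"
        have "Cauchy ?s" using s LIMSEQ_imp_Cauchy by blast
        \<comment> \<open>\<open>C\<close> may be 0, so the tolerance is divided by
          \<open>C + 1\<close>.\<close>
        moreover have "e / (C + 1) > 0" using \<open>e > 0\<close> C(1) by simp
        ultimately obtain M where M: "\<forall>m\<ge>M. \<forall>n\<ge>M. dist (?s m) (?s n) < e / (C + 1)"
          unfolding Cauchy_def by blast
        have "dist (c m b) (c n b) < e" if "m \<ge> M" "n \<ge> M" for m n
        proof -
          have "dist (c m b) (c n b) \<le> C * dist (?s m) (?s n)"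
            using C(2)[OF b, of "\<lambda>b. c m b - c n b"]
            by (simp add: dist_norm scaleR_left_diff_distrib sum_subtractf)
          also have "\<dots> \<le> (C + 1) * dist (?s m) (?s n)"
            by (simp add: mult_right_mono)
          also have "\<dots> < e"
            using M that C(1) by (simp add: pos_less_divide_eq mult.commute)
          finally show ?thesis .
        qed
        then show "\<exists>M. \<forall>m\<ge>M. \<forall>n\<ge>M. dist (c m b) (c n b) < e" by blast
      qed
      then show ?thesis using real_Cauchy_convergent convergent_def by blast
    qed
    then obtain l where l: "\<And>b. b \<in> B \<Longrightarrow> (\<lambda>n. c n b) \<longlonglongrightarrow> l b" by metis
    have "?s \<longlonglongrightarrow> (\<Sum>b\<in>B. l b *\<^sub>R b)"
      by (intro tendsto_sum tendsto_scaleR l tendsto_const)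
    then have "- a = (\<Sum>b\<in>B. l b *\<^sub>R b)" using s LIMSEQ_unique by blast
    moreover have "(\<Sum>b\<in>B. l b *\<^sub>R b) \<in> span B"
      by (intro span_sum span_scale span_base)
    ultimately show False using a by (metis span_neg add.inverse_inverse)
  qed
  then obtain d where d: "d > 0" "\<And>c. d \<le> norm (a + (\<Sum>b\<in>B. c b *\<^sub>R b))" by metis
  \<comment> \<open>The summand \<open>1 / d\<close> bounds the coefficient of \<open>a\<close>. The
    other one bounds the coefficients over \<open>B\<close>, whose combination has norm at most
    \<open>1 + norm a / d\<close> times that of the full combination.\<close>
  define K where "K = 1 / d + C * (1 + norm a / d)"
  have "\<bar>c b\<bar> \<le> K * norm (\<Sum>b\<in>insert a B. c b *\<^sub>R b)" if b: "b \<in> insert a B" for c b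
  proof -
    let ?s = "\<Sum>b\<in>B. c b *\<^sub>R b"
    let ?t = "norm (c a *\<^sub>R a + ?s)"
    have ca: "\<bar>c a\<bar> \<le> ?t / d"
    proof (cases "c a = 0")
      case False
      have "d \<le> norm (a + (\<Sum>b\<in>B. (c b / c a) *\<^sub>R b))" by (rule d(2))
      also have "(\<Sum>b\<in>B. (c b / c a) *\<^sub>R b) = (1 / c a) *\<^sub>R ?s"
        by (simp add: scaleR_sum_right)
      also have "a + \<dots> = (1 / c a) *\<^sub>R (c a *\<^sub>R a + ?s)"
        using False by (simp add: scaleR_add_right)
      finally have "d \<le> ?t / \<bar>c a\<bar>" by simp
      then have "d * \<bar>c a\<bar> \<le> ?t" using False by (simp add: pos_le_divide_eq)
      then show ?thesis using d(1) by (simp add: pos_le_divide_eq mult.commute)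
    qed (use d(1) in simp)
    have "norm ?s \<le> ?t + \<bar>c a\<bar> * norm a"
      using norm_triangle_ineq4[of "c a *\<^sub>R a + ?s" "c a *\<^sub>R a"] by simp
    also have "\<dots> \<le> ?t + ?t / d * norm a"
      using ca by (intro add_left_mono mult_right_mono) auto
    finally have "C * norm ?s \<le> C * (?t + ?t / d * norm a)"
      using C(1) by (rule mult_left_mono)
    also have "\<dots> = C * (1 + norm a / d) * ?t" by (simp add: distrib_left distrib_right)
    finally have s: "C * norm ?s \<le> C * (1 + norm a / d) * ?t" .
    have K: "K * ?t = ?t / d + C * (1 + norm a / d) * ?t"
      by (simp add: K_def distrib_right)
    have "0 \<le> C * (1 + norm a / d) * ?t"
      using C(1) d(1) by (intro mult_nonneg_nonneg add_nonneg_nonneg) auto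
    moreover have "0 \<le> ?t / d" using d(1) by simp
    ultimately have "\<bar>c b\<bar> \<le> K * ?t"
      using ca s b C(2)[of b c] unfolding K by (cases "b = a") auto
    then show ?thesis using insert.hyps by simp
  qed
  moreover have "K \<ge> 0" unfolding K_def using C(1) d(1) by simp
  ultimately show ?case by blast
qed

text \<open>The expansion identity is the form in which a basis and its coordinate functionals are
  used: it writes functionals, gradients and linear maps as finite sums. Dimension 0 is covered by
  an empty \<open>E\<close>.\<close>

locale dual_basis =
  fixes E :: "'g::real_normed_vector set" and \<epsilon> :: "'g \<Rightarrow> 'g dual"
  assumes finite_E: "finite E"
    and expansion: "\<xi> = (\<Sum>e\<in>E. \<epsilon> e \<xi> *\<^sub>R e)"
begin

text \<open>Reflexivity in coordinates: expanding \<open>\<nu>\<close> along the functionals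
  \<open>\<epsilon> e\<close> shows that every element of the bidual is evaluation at a
  vector.\<close>

lemma linear_dual_eq:
  fixes L :: "'g dual \<Rightarrow> real" and \<nu> :: "'g dual"
  assumes "linear L"
  shows "\<nu> (\<Sum>e\<in>E. L (\<epsilon> e) *\<^sub>R e) = L \<nu>"
proof -
  have "\<nu> = (\<Sum>e\<in>E. \<nu> e *\<^sub>R \<epsilon> e)"
  proof (rule blinfun_eqI)
    show "\<nu> \<xi> = (\<Sum>e\<in>E. \<nu> e *\<^sub>R \<epsilon> e) \<xi>" for \<xi>
      by (subst expansion[of \<xi>])
        (simp add: blinfun.sum_right blinfun.sum_left blinfun.scaleR_right blinfun.scaleR_left mult.commute)
  qed
  then have "L \<nu> = L (\<Sum>e\<in>E. \<nu> e *\<^sub>R \<epsilon> e)" by simp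
  also have "\<dots> = (\<Sum>e\<in>E. \<nu> e * L (\<epsilon> e))"
    using assms by (simp add: linear_sum linear_scale)
  finally show ?thesis
    by (simp add: blinfun.sum_right blinfun.scaleR_right mult.commute)
qed

lemma dual_separates: "(\<And>\<nu> :: 'g dual. \<nu> \<xi> = \<nu> \<eta>) \<Longrightarrow> \<xi> = \<eta>"
  using expansion[of \<xi>] expansion[of \<eta>] by simp

lemma linear_bounded_linear:
  fixes f :: "'g \<Rightarrow> 'b::real_normed_vector"
  assumes "linear f" shows "bounded_linear f"
proof -
  have "f \<xi> = (\<Sum>e\<in>E. \<epsilon> e \<xi> *\<^sub>R f e)" for \<xi>
    using assms by (subst expansion[of \<xi>]) (simp add: linear_sum linear_scale)
  then have "f = (\<lambda>\<xi>. \<Sum>e\<in>E. \<epsilon> e \<xi> *\<^sub>R f e)" by (rule ext)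
  moreover have "bounded_linear (\<lambda>\<xi>. \<Sum>e\<in>E. \<epsilon> e \<xi> *\<^sub>R f e)"
    by (intro bounded_linear_sum bounded_linear_scaleR_const blinfun.bounded_linear_right)
  ultimately show ?thesis by simp
qed

text \<open>The derivative of \<open>f\<close> in \<mu> as an element of the Lie algebra. In
  contrast to the description in \<open>partial_mu\<close>, the finite sum can itself be
  differentiated term by term.\<close>

definition grad :: "('g dual \<times> real \<Rightarrow> real) \<Rightarrow> 'g dual \<times> real \<Rightarrow> 'g" where
  "grad f x = (\<Sum>e\<in>E. D f x (\<epsilon> e, 0) *\<^sub>R e)"

lemma linear_fst_slice: "linear L \<Longrightarrow> linear (\<lambda>\<nu>. L (\<nu>, 0))"
  for L :: "'c::real_vector \<times> real \<Rightarrow> real"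
  unfolding linear_iff by (metis add_Pair add_0 scaleR_Pair scaleR_zero_right)

lemma apply_grad:
  assumes "f differentiable (at x)"
  shows "blinfun_apply \<nu> (grad f x) = D f x (\<nu>, 0)"
  unfolding grad_def
  by (rule linear_dual_eq[OF linear_fst_slice[OF linear_frechet_derivative[OF assms]]])

text \<open>\<open>apply_grad\<close> shows that \<open>grad\<close> satisfies the description, and
  separation of points by functionals makes it the only such vector.\<close>

lemma partial_mu_eq:
  assumes "f differentiable (at (\<mu>, z))"
  shows "partial_mu f \<mu> z = grad f (\<mu>, z)"
proof -
  have "D (\<lambda>\<mu>'. f (\<mu>', z)) \<mu> = (\<lambda>\<nu>. D f (\<mu>, z) (\<nu>, 0))"
    by (rule D_eqI, rule has_derivative_compose[of "\<lambda>\<mu>'. (\<mu>', z)"])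
      (use assms in \<open>auto intro!: derivative_eq_intros simp: frechet_derivative_works[symmetric]\<close>)
  then show ?thesis
    unfolding partial_mu_def
    by (intro the_equality) (auto simp: apply_grad[OF assms] intro!: dual_separates)
qed

end

text \<open>The functionals are the coordinates in an independent spanning subset;
  \<open>coefficients_bounded\<close> lets \<open>Blinfun\<close> represent them faithfully.\<close>

lemma fin_dim_dual_basis:
  assumes "fin_dim (UNIV :: 'a::real_normed_vector set)"
  obtains E :: "'a::real_normed_vector set" and \<epsilon> :: "'a \<Rightarrow> 'a dual"
  where "dual_basis E \<epsilon>"
proof -
  obtain B0 :: "'a set" where B0: "finite B0" "span B0 = UNIV"
    using assms unfolding fin_dim_def by blast
  obtain E where E: "E \<subseteq> B0" "independent E" "B0 \<subseteq> span E"
    using maximal_independent_subset[of B0] by blast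
  have fin: "finite E" using E(1) B0(1) finite_subset by blast
  have sp: "span E = UNIV" using E(3) B0(2) span_minimal[OF E(3) subspace_span] by auto
  have ex: "(\<Sum>e\<in>E. representation E \<xi> e *\<^sub>R e) = \<xi>" for \<xi>
    by (rule sum_representation_eq) (use E fin sp in auto)
  obtain C where C: "\<And>c b. b \<in> E \<Longrightarrow> \<bar>c b\<bar> \<le> C * norm (\<Sum>b\<in>E. c b *\<^sub>R b)"
    using coefficients_bounded[OF fin E(2)] by metis
  have bl: "bounded_linear (\<lambda>\<xi>. representation E \<xi> e)" if "e \<in> E" for e
  proof (rule bounded_linear_intro[where K = C])
    show "norm (representation E \<xi> e) \<le> norm \<xi> * C" for \<xi>
      using C[OF that, of "representation E \<xi>"] ex[of \<xi>] by (simp add: mult.commute)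
  qed (simp_all add: representation_add representation_scale E(2) sp)
  have "dual_basis E (\<lambda>e. Blinfun (\<lambda>\<xi>. representation E \<xi> e))"
  proof
    show "\<xi> = (\<Sum>e\<in>E. Blinfun (\<lambda>\<xi>. representation E \<xi> e) \<xi> *\<^sub>R e)" for \<xi>
      using ex[of \<xi>] by (simp add: bounded_linear_Blinfun_apply bl cong: sum.cong)
  qed (rule fin)
  then show thesis by (rule that)
qed

section \<open>The Lie algebra of a Lie group\<close>

text \<open>The laws hold for commutators of operators and are pulled back along the injective
  \<iota>. In the Jacobi identity the twelve threefold compositions cancel in pairs.\<close>

lemma lie_algebra_of_laws:
  fixes br :: "'g::real_vector \<Rightarrow> 'g \<Rightarrow> 'g"
  assumes "is_lie_algebra_of br G A"
  shows "bilinear br" "br \<xi> \<eta> = - br \<eta> \<xi>" "br (br \<xi> \<eta>) \<zeta> + br (br \<eta> \<zeta>) \<xi> + br (br \<zeta> \<xi>) \<eta> = 0"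
proof -
  define S where "S = smooth_functions A"
  obtain \<iota> where bij: "bij_betw \<iota> UNIV (left_invariant_fields G A)"
    and \<iota>_lin: "\<And>a b \<xi> \<eta> f p. \<iota> (a *\<^sub>R \<xi> + b *\<^sub>R \<eta>) f p = a * \<iota> \<xi> f p + b * \<iota> \<eta> f p"
    and \<iota>_br: "\<And>\<xi> \<eta> f p. f \<in> S \<Longrightarrow> \<iota> (br \<xi> \<eta>) f p = \<iota> \<xi> (\<iota> \<eta> f) p - \<iota> \<eta> (\<iota> \<xi> f) p"
    using assms unfolding is_lie_algebra_of_def S_def by blast
  have "\<iota> \<xi> \<in> left_invariant_fields G A" for \<xi>
    using bij bij_betwE by blast
  then have off: "f \<notin> S \<Longrightarrow> \<iota> \<xi> f = (\<lambda>_. 0)" and pres: "f \<in> S \<Longrightarrow> \<iota> \<xi> f \<in> S"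
    and lin: "f \<in> S \<Longrightarrow> h \<in> S \<Longrightarrow> \<iota> \<xi> (\<lambda>p. a * f p + b * h p) = (\<lambda>p. a * \<iota> \<xi> f p + b * \<iota> \<xi> h p)"
    for f h a b \<xi>
    unfolding left_invariant_fields_def S_def by blast+
  \<comment> \<open>Left-invariant fields vanish off the smooth functions, so agreement on smooth
    functions already gives equality of operators.\<close>
  have eqI: "\<xi> = \<eta>" if "\<And>f p. f \<in> S \<Longrightarrow> \<iota> \<xi> f p = \<iota> \<eta> f p" for \<xi> \<eta>
  proof -
    have "\<iota> \<xi> f = \<iota> \<eta> f" for f using that off[of f] by (cases "f \<in> S") auto
    then show ?thesis using bij by (metis bij_betw_imp_inj_on ext injD)
  qed
  have add: "\<iota> (\<xi> + \<eta>) f p = \<iota> \<xi> f p + \<iota> \<eta> f p" for \<xi> \<eta> f p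
    using \<iota>_lin[of 1 \<xi> 1 \<eta>] by simp
  have minus: "\<iota> (- \<xi>) f p = - \<iota> \<xi> f p" for \<xi> f p
    using \<iota>_lin[of "- 1" \<xi> 0 \<xi>] by simp
  have zero: "\<iota> 0 f p = 0" for f p
    using \<iota>_lin[of 0 0 0 0] by simp
  have alt: "br \<xi> \<eta> = - br \<eta> \<xi>" for \<xi> \<eta>
    by (rule eqI) (simp add: minus \<iota>_br)
  have left: "br (a *\<^sub>R \<xi> + b *\<^sub>R \<eta>) \<zeta> = a *\<^sub>R br \<xi> \<zeta> + b *\<^sub>R br \<eta> \<zeta>" for a b \<xi> \<eta> \<zeta>
  proof (rule eqI)
    fix f p assume f: "f \<in> S"
    have "\<iota> (a *\<^sub>R \<xi> + b *\<^sub>R \<eta>) f = (\<lambda>p. a * \<iota> \<xi> f p + b * \<iota> \<eta> f p)"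
      using \<iota>_lin by blast
    then have "\<iota> \<zeta> (\<iota> (a *\<^sub>R \<xi> + b *\<^sub>R \<eta>) f) p = a * \<iota> \<zeta> (\<iota> \<xi> f) p + b * \<iota> \<zeta> (\<iota> \<eta> f) p"
      using f by (simp add: lin pres)
    then show "\<iota> (br (a *\<^sub>R \<xi> + b *\<^sub>R \<eta>) \<zeta>) f p = \<iota> (a *\<^sub>R br \<xi> \<zeta> + b *\<^sub>R br \<eta> \<zeta>) f p"
      using f by (simp add: \<iota>_br \<iota>_lin algebra_simps)
  qed
  have left_add: "br (\<xi> + \<eta>) \<zeta> = br \<xi> \<zeta> + br \<eta> \<zeta>" for \<xi> \<eta> \<zeta>
    using left[of 1 \<xi> 1 \<eta>] by simp
  have left_scale: "br (c *\<^sub>R \<xi>) \<zeta> = c *\<^sub>R br \<xi> \<zeta>" for c \<xi> \<zeta>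
    using left[of c \<xi> 0 0] by simp
  have "br \<zeta> (\<xi> + \<eta>) = br \<zeta> \<xi> + br \<zeta> \<eta>" "br \<zeta> (c *\<^sub>R \<xi>) = c *\<^sub>R br \<zeta> \<xi>" for c \<xi> \<eta> \<zeta>
    using left_add[of \<xi> \<eta> \<zeta>] left_scale[of c \<xi> \<zeta>]
    by (simp_all add: alt[of \<zeta>])
  then show "bilinear br"
    by (simp add: bilinear_def linear_iff left_add left_scale)
  show "br \<xi> \<eta> = - br \<eta> \<xi>" by (rule alt)
  show "br (br \<xi> \<eta>) \<zeta> + br (br \<eta> \<zeta>) \<xi> + br (br \<zeta> \<xi>) \<eta> = 0"
  proof (rule eqI)
    fix f p assume f: "f \<in> S"
    have "\<iota> \<zeta> (\<iota> (br \<xi> \<eta>) f) p = \<iota> \<zeta> (\<iota> \<xi> (\<iota> \<eta> f)) p - \<iota> \<zeta> (\<iota> \<eta> (\<iota> \<xi> f)) p" for \<xi> \<eta> \<zeta>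
    proof -
      \<comment> \<open>The coefficients 1 and -1 present the commutator as the kind of linear
        combination to which \<open>lin\<close> applies.\<close>
      have "\<iota> (br \<xi> \<eta>) f = (\<lambda>p. 1 * \<iota> \<xi> (\<iota> \<eta> f) p + (- 1) * \<iota> \<eta> (\<iota> \<xi> f) p)"
        using f by (simp add: \<iota>_br fun_eq_iff)
      then show ?thesis
        using lin[of "\<iota> \<xi> (\<iota> \<eta> f)" "\<iota> \<eta> (\<iota> \<xi> f)" \<zeta> 1 "- 1"] f by (simp add: pres)
    qed
    then show "\<iota> (br (br \<xi> \<eta>) \<zeta> + br (br \<eta> \<zeta>) \<xi> + br (br \<zeta> \<xi>) \<eta>) f p = \<iota> 0 f p"
      using f by (simp add: add zero \<iota>_br pres)
  qed
qed

section \<open>The Jacobi structure\<close>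

text \<open>Both sides of the identity for the Schouten bracket of \<Lambda> with itself are signed
  sums of this shape. Peeling off one index at a time writes each permutation as a product of
  transpositions.\<close>

lemma sum_permutes_3:
  fixes P :: "nat \<Rightarrow> nat \<Rightarrow> nat \<Rightarrow> real"
  shows "(\<Sum>\<sigma> | \<sigma> permutes {..<3::nat}. of_int (sign \<sigma>) * P (\<sigma> 0) (\<sigma> 1) (\<sigma> 2)) =
    P 0 1 2 - P 0 2 1 - P 1 0 2 + P 1 2 0 + P 2 0 1 - P 2 1 0"
proof -
  have e: "{..<3} = insert 0 (insert 1 {2::nat})" by auto
  have p: "permutation (Transposition.transpose a b)" for a b :: nat
    by (rule permutation_swap_id)
  show ?thesis
    unfolding e
    by (subst sum_over_permutations_insert, simp, simp, subst sum_over_permutations_insert, simp, simp)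
      (simp add: permutes_sing sign_compose permutation_compose p sign_swap_id)
qed

lemma partial_z_eq:
  assumes "f differentiable (at (\<mu>, z))"
  shows "partial_z f \<mu> z = D f (\<mu>, z) (0, 1)"
proof -
  have "((\<lambda>t. f (\<mu>, t)) has_derivative (\<lambda>s. D f (\<mu>, z) (0, s))) (at z)"
    by (rule has_derivative_compose[of "\<lambda>t. (\<mu>, t)"])
      (use assms in \<open>auto intro!: derivative_eq_intros simp: frechet_derivative_works[symmetric]\<close>)
  moreover have "(\<lambda>s. D f (\<mu>, z) (0, s)) = (*) (D f (\<mu>, z) (0, 1))"
  proof
    show "D f (\<mu>, z) (0, s) = D f (\<mu>, z) (0, 1) * s" for s
      using linear_scale[OF linear_frechet_derivative[OF assms], of s "(0, 1)"] by simp
  qed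
  ultimately show ?thesis
    unfolding partial_z_def by (intro DERIV_imp_deriv) (simp only: has_field_derivative_def)
qed

lemma differential_apply:
  assumes "f differentiable (at x)"
  shows "blinfun_apply (differential f x) = D f x"
  unfolding differential_def using assms
  by (simp add: bounded_linear_Blinfun_apply frechet_derivative_works has_derivative_bounded_linear)

lemma D_blinfun [simp]: "D (blinfun_apply \<alpha>) x = blinfun_apply \<alpha>"
  by (rule D_eqI, rule bounded_linear_imp_has_derivative, rule blinfun.bounded_linear_right)

lemma blinfun_differentiable [simp]: "blinfun_apply \<alpha> differentiable (at x)"
  by (rule bounded_linear_imp_differentiable, rule blinfun.bounded_linear_right)

lemma smooth_apply_fst: "smooth (\<lambda>x :: 'g::real_normed_vector dual \<times> real. blinfun_apply (fst x) \<xi>)"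
  by (intro smooth_bounded_linear bounded_linear_compose[OF blinfun.bounded_linear_left] bounded_linear_fst)

section \<open>The Lie algebra bracket and the bivector field\<close>

locale lie_algebra_basis = dual_basis E \<epsilon>
  for E :: "'g::real_normed_vector set" and \<epsilon> :: "'g \<Rightarrow> 'g dual" +
  fixes br :: "'g \<Rightarrow> 'g \<Rightarrow> 'g"
  assumes bilinear_br: "bilinear br"
    and br_skew: "br \<xi> \<eta> = - br \<eta> \<xi>"
    and br_jacobi: "br (br \<xi> \<eta>) \<zeta> + br (br \<eta> \<zeta>) \<xi> + br (br \<zeta> \<xi>) \<eta> = 0"
begin

lemmas br_simps = bilinear_ladd[OF bilinear_br] bilinear_radd[OF bilinear_br]
  bilinear_lsub[OF bilinear_br] bilinear_rsub[OF bilinear_br]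
  bilinear_lmul[OF bilinear_br] bilinear_rmul[OF bilinear_br]

lemma bounded_linear_br: "bounded_linear (\<lambda>\<xi>. br \<xi> \<eta>)"
  by (rule linear_bounded_linear) (use bilinear_br in \<open>simp add: bilinear_def\<close>)

text \<open>Gives the product rule for \<open>br\<close> and the expansion of sums in either
  argument. Expanding the first argument in the dual basis leaves finitely many bounded maps
  \<open>br e\<close>.\<close>

lemma bounded_bilinear_br: "bounded_bilinear br"
proof -
  have l: "bounded_linear (br \<xi>)" for \<xi>
    by (rule linear_bounded_linear) (use bilinear_br in \<open>simp add: bilinear_def\<close>)
  have "br \<xi> \<eta> = (\<Sum>e\<in>E. \<epsilon> e \<xi> *\<^sub>R br e \<eta>)" for \<xi> \<eta>
    using bilinear_br by (subst expansion[of \<xi>])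
      (simp add: bilinear_def linear_sum[of "\<lambda>\<xi>. br \<xi> \<eta>"] linear_scale[of "\<lambda>\<xi>. br \<xi> \<eta>"])
  then have "br = (\<lambda>\<xi> \<eta>. \<Sum>e\<in>E. \<epsilon> e \<xi> *\<^sub>R br e \<eta>)" by (intro ext)
  moreover have "bounded_bilinear (\<lambda>\<xi> \<eta>. \<Sum>e\<in>E. \<epsilon> e \<xi> *\<^sub>R br e \<eta>)"
  proof -
    have bound: "norm (\<Sum>e\<in>E. \<epsilon> e \<xi> *\<^sub>R br e \<eta>) \<le> norm \<xi> * norm \<eta> * (\<Sum>e\<in>E. norm (\<epsilon> e) * onorm (br e))" for \<xi> \<eta>
    proof -
      have "norm (\<epsilon> e \<xi> *\<^sub>R br e \<eta>) \<le> (norm (\<epsilon> e) * norm \<xi>) * (onorm (br e) * norm \<eta>)" for e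
        unfolding norm_scaleR
        by (intro mult_mono norm_blinfun[of "\<epsilon> e", unfolded real_norm_def] onorm[OF l])
          (auto intro: mult_nonneg_nonneg)
      then have "norm (\<Sum>e\<in>E. \<epsilon> e \<xi> *\<^sub>R br e \<eta>) \<le> (\<Sum>e\<in>E. (norm (\<epsilon> e) * norm \<xi>) * (onorm (br e) * norm \<eta>))"
        by (intro sum_norm_le)
      then show ?thesis by (simp add: sum_distrib_left mult_ac)
    qed
    show ?thesis
    proof
      show "\<exists>K. \<forall>\<xi> \<eta>. norm (\<Sum>e\<in>E. \<epsilon> e \<xi> *\<^sub>R br e \<eta>) \<le> norm \<xi> * norm \<eta> * K"
        using bound by blast
    qed (simp_all add: blinfun.add_right blinfun.scaleR_right br_simps scaleR_add_left
      scaleR_add_right sum.distrib scaleR_sum_right mult.commute)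
  qed
  ultimately show ?thesis by simp
qed

abbreviation \<Lambda> where "\<Lambda> \<equiv> lie_Lambda br"

abbreviation bracket :: "('g dual \<times> real \<Rightarrow> real) \<Rightarrow> ('g dual \<times> real \<Rightarrow> real) \<Rightarrow> 'g dual \<times> real \<Rightarrow> real"
  where "bracket \<equiv> induced_bracket \<Lambda> lie_E"

text \<open>A covector on the product is a pair of a Lie algebra element and a number;
  \<open>covec \<alpha>\<close> is the first component, and \<open>\<alpha> (0, 1)\<close> is the
  second.\<close>

definition covec :: "('g dual \<times> real) dual \<Rightarrow> 'g" where
  "covec \<alpha> = (\<Sum>e\<in>E. \<alpha> (\<epsilon> e, 0) *\<^sub>R e)"

lemma grad_covec: "grad (blinfun_apply \<alpha>) x = covec \<alpha>"
  by (simp add: grad_def covec_def)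

lemma covec_differential: "f differentiable (at x) \<Longrightarrow> covec (differential f x) = grad f x"
  by (simp add: grad_def covec_def differential_apply)

lemma covec_add: "covec (\<alpha> + \<beta>) = covec \<alpha> + covec \<beta>"
  by (simp add: covec_def blinfun.add_left scaleR_add_left sum.distrib)

lemma covec_scaleR: "covec (c *\<^sub>R \<alpha>) = c *\<^sub>R covec \<alpha>"
  by (simp add: covec_def blinfun.scaleR_left scaleR_sum_right)

lemma apply_covec: "blinfun_apply \<nu> (covec \<alpha>) = \<alpha> (\<nu>, 0)"
  \<comment> \<open>A linear function has the same gradient everywhere, so the base point is
    arbitrary.\<close>
  using apply_grad[of "blinfun_apply \<alpha>" undefined \<nu>] by (simp add: grad_covec)

lemma Lambda_eq:
  "\<Lambda> x \<alpha> \<beta> = blinfun_apply (fst x) (br (covec \<alpha>) (covec \<beta>)) + blinfun_apply (fst x) (covec \<alpha>) * \<beta> (0, 1) - blinfun_apply (fst x) (covec \<beta>) * \<alpha> (0, 1)"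
  by (cases x) (simp add: lie_Lambda_def partial_mu_eq partial_z_eq grad_covec)

lemma Lambda_differential:
  assumes "f differentiable (at x)" "g differentiable (at x)"
  shows "\<Lambda> x (differential f x) (differential g x) =
    blinfun_apply (fst x) (br (grad f x) (grad g x)) + D f x (fst x, 0) * D g x (0, 1) - D g x (fst x, 0) * D f x (0, 1)"
  using assms by (simp add: Lambda_eq covec_differential differential_apply apply_grad)

lemma Lambda_skew: "\<Lambda> x \<alpha> \<beta> = - \<Lambda> x \<beta> \<alpha>"
  using br_skew[of "covec \<alpha>" "covec \<beta>"] by (simp add: Lambda_eq blinfun.minus_right)

lemma bivector_field_Lambda: "bivector_field \<Lambda>"
  unfolding bivector_field_def
proof (intro conjI allI)
  show "bilinear (\<Lambda> x)" for x
    by (simp add: bilinear_def linear_iff Lambda_eq covec_add covec_scaleR br_simps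
      blinfun.add_left blinfun.add_right blinfun.scaleR_left blinfun.scaleR_right algebra_simps)
  show "\<Lambda> x \<alpha> \<beta> = - \<Lambda> x \<beta> \<alpha>" for x \<alpha> \<beta> by (rule Lambda_skew)
  show "smooth (\<lambda>x. \<Lambda> x \<alpha> \<beta>)" for \<alpha> \<beta>
    unfolding Lambda_eq by (intro smooth_add smooth_diff smooth_mult smooth_apply_fst smooth_const)
qed

text \<open>On fixed covectors \<Lambda> is evaluation of \<mu> at one vector, hence linear and
  equal to its own derivative, with no component along z. This is the inner differential in the
  Schouten brackets.\<close>

lemma
  fixes \<nu> :: "'g dual"
  shows differential_Lambda_apply: "differential (\<lambda>y. \<Lambda> y \<alpha> \<beta>) x (\<nu>, s) =
      \<nu> (br (covec \<alpha>) (covec \<beta>) + \<beta> (0, 1) *\<^sub>R covec \<alpha> - \<alpha> (0, 1) *\<^sub>R covec \<beta>)"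
    and covec_differential_Lambda: "covec (differential (\<lambda>y. \<Lambda> y \<alpha> \<beta>) x) =
      br (covec \<alpha>) (covec \<beta>) + \<beta> (0, 1) *\<^sub>R covec \<alpha> - \<alpha> (0, 1) *\<^sub>R covec \<beta>"
proof -
  let ?\<xi> = "br (covec \<alpha>) (covec \<beta>) + \<beta> (0, 1) *\<^sub>R covec \<alpha> - \<alpha> (0, 1) *\<^sub>R covec \<beta>"
  have e: "(\<lambda>y. \<Lambda> y \<alpha> \<beta>) = (\<lambda>y. blinfun_apply (fst y) ?\<xi>)"
    by (simp add: Lambda_eq fun_eq_iff blinfun.add_right blinfun.diff_right blinfun.scaleR_right)
  have bl: "bounded_linear (\<lambda>y :: 'g dual \<times> real. blinfun_apply (fst y) ?\<xi>)"
    by (intro bounded_linear_compose[OF blinfun.bounded_linear_left] bounded_linear_fst)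
  show *: "differential (\<lambda>y. \<Lambda> y \<alpha> \<beta>) x (\<nu>, s) = \<nu> ?\<xi>" for \<nu> :: "'g dual" and s
    unfolding e
    using bounded_linear_imp_differentiable[OF bl] D_eqI[OF bounded_linear_imp_has_derivative[OF bl]]
    by (simp add: differential_apply)
  show "covec (differential (\<lambda>y. \<Lambda> y \<alpha> \<beta>) x) = ?\<xi>"
    by (rule dual_separates) (simp add: apply_covec *)
qed

section \<open>The two Schouten identities\<close>

lemma jacobi_structure_Lambda: "jacobi_structure \<Lambda> lie_E"
proof -
  have "schouten 2 2 (of_bivector \<Lambda>) (of_bivector \<Lambda>) x \<alpha>
      = 2 * wedge 1 2 (of_vector lie_E) (of_bivector \<Lambda>) x \<alpha>" for x \<alpha>
  proof -
    let ?T = "\<lambda>i j k. \<Lambda> x (differential (\<lambda>y. \<Lambda> y (\<alpha> i) (\<alpha> j)) x) (\<alpha> k)"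
    let ?W = "\<lambda>i j k. \<alpha> i (lie_E x) * \<Lambda> x (\<alpha> j) (\<alpha> k)"
    have n: "{..<2 + 2 - 1} = {..<3::nat}" "{..<1 + 2} = {..<3::nat}" by auto
    \<comment> \<open>For degrees 2 and 2 the sign in \<open>schouten\<close> is -1, so the two
      equal compositions add up, and the resulting 2 cancels the normalisation
      \<open>1 / (fact 2 * fact 1)\<close>.\<close>
    have S: "schouten 2 2 (of_bivector \<Lambda>) (of_bivector \<Lambda>) x \<alpha> =
        (\<Sum>\<sigma> | \<sigma> permutes {..<3::nat}. of_int (sign \<sigma>) * ?T (\<sigma> 0) (\<sigma> 1) (\<sigma> 2))"
      unfolding schouten_def mv_comp_def of_bivector_def n by (simp add: numeral_2_eq_2)
    have W: "2 * wedge 1 2 (of_vector lie_E) (of_bivector \<Lambda>) x \<alpha> =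
        (\<Sum>\<sigma> | \<sigma> permutes {..<3::nat}. of_int (sign \<sigma>) * ?W (\<sigma> 0) (\<sigma> 1) (\<sigma> 2))"
      unfolding wedge_def of_bivector_def of_vector_def n
      by (simp add: mult.assoc) (simp add: numeral_2_eq_2)
    let ?a = "\<lambda>i. covec (\<alpha> i)"
    have jac: "blinfun_apply (fst x) (br (br (?a 0) (?a 1)) (?a 2)) + blinfun_apply (fst x) (br (br (?a 1) (?a 2)) (?a 0))
        + blinfun_apply (fst x) (br (br (?a 2) (?a 0)) (?a 1)) = 0"
      using br_jacobi[of "?a 0" "?a 1" "?a 2"]
      by (metis blinfun.add_right blinfun.zero_right)
    have T: "?T i j k = blinfun_apply (fst x) (br (br (?a i) (?a j)) (?a k)) + \<alpha> j (0, 1) * blinfun_apply (fst x) (br (?a i) (?a k))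
        - \<alpha> i (0, 1) * blinfun_apply (fst x) (br (?a j) (?a k)) + (blinfun_apply (fst x) (br (?a i) (?a j))
        + \<alpha> j (0, 1) * blinfun_apply (fst x) (?a i) - \<alpha> i (0, 1) * blinfun_apply (fst x) (?a j)) * \<alpha> k (0, 1)" for i j k
      by (simp add: Lambda_eq[of x "differential (\<lambda>y. \<Lambda> y (\<alpha> i) (\<alpha> j)) x"]
        covec_differential_Lambda differential_Lambda_apply br_simps
        blinfun.add_right blinfun.diff_right blinfun.scaleR_right blinfun.zero_left)
    have E: "\<alpha> i (lie_E x) = - \<alpha> i (0, 1)" for i
      using blinfun.minus_right[of "\<alpha> i" "(0, 1)"] by (cases x) (simp add: lie_E_def)
    have sk: "blinfun_apply (fst x) (br (?a 1) (?a 0)) = - blinfun_apply (fst x) (br (?a 0) (?a 1))"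
      "blinfun_apply (fst x) (br (?a 2) (?a 0)) = - blinfun_apply (fst x) (br (?a 0) (?a 2))"
      "blinfun_apply (fst x) (br (?a 2) (?a 1)) = - blinfun_apply (fst x) (br (?a 1) (?a 2))"
      using br_skew by (metis blinfun.minus_right)+
    have skl: "br (br \<xi> \<eta>) \<zeta> = - br (br \<eta> \<xi>) \<zeta>" for \<xi> \<eta> \<zeta>
      using br_skew[of \<xi> \<eta>] bilinear_lneg[OF bilinear_br] by metis
    \<comment> \<open>The six double brackets are oriented as in \<open>jac\<close>; in the
      alternating sum each cyclic term then occurs twice with sign plus, so they vanish
      together.\<close>
    have sk3: "blinfun_apply (fst x) (br (br (?a 1) (?a 0)) (?a 2)) = - blinfun_apply (fst x) (br (br (?a 0) (?a 1)) (?a 2))"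
      "blinfun_apply (fst x) (br (br (?a 2) (?a 1)) (?a 0)) = - blinfun_apply (fst x) (br (br (?a 1) (?a 2)) (?a 0))"
      "blinfun_apply (fst x) (br (br (?a 0) (?a 2)) (?a 1)) = - blinfun_apply (fst x) (br (br (?a 2) (?a 0)) (?a 1))"
      using skl by (metis blinfun.minus_right)+
    show ?thesis
      unfolding S W sum_permutes_3[of ?T] sum_permutes_3[of ?W]
      unfolding T E
      unfolding Lambda_eq sk sk3
      using jac by (simp add: algebra_simps)
  qed
  moreover have "schouten 1 2 (of_vector lie_E) (of_bivector \<Lambda>) x \<alpha> = 0" for x \<alpha>
  proof -
    \<comment> \<open>\<Lambda> does not depend on z, so its derivative along \<open>lie_E\<close>
      vanishes; the other composition vanishes because \<open>lie_E\<close> is constant.\<close>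
    have z: "differential (\<lambda>y. \<Lambda> y \<beta> \<gamma>) x (lie_E x) = 0" for \<beta> \<gamma>
      by (cases x) (simp add: lie_E_def differential_Lambda_apply)
    have d: "differential (\<lambda>y :: 'g dual \<times> real. \<beta> (lie_E y)) x = 0" for \<beta>
    proof -
      have "(\<lambda>y :: 'g dual \<times> real. \<beta> (lie_E y)) = (\<lambda>y. \<beta> (0, - 1))"
        by (simp add: lie_E_def split_beta)
      then show ?thesis by (simp add: differential_def zero_blinfun_def)
    qed
    have "\<Lambda> x 0 \<beta> = 0" for \<beta>
      using bivector_field_Lambda unfolding bivector_field_def by (blast intro: bilinear_lzero)
    then show ?thesis
      unfolding schouten_def mv_comp_def of_bivector_def of_vector_def by (simp add: z d)
  qed
  moreover have "vector_field lie_E"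
    unfolding vector_field_def lie_E_def split_beta by (rule smooth_const)
  ultimately show ?thesis
    unfolding jacobi_structure_def using bivector_field_Lambda by (intro conjI ext)
qed

section \<open>The bracket and its Hamiltonian vector fields\<close>

definition leg :: "('g dual \<times> real \<Rightarrow> real) \<Rightarrow> 'g dual \<times> real \<Rightarrow> real" where
  "leg f x = D f x (fst x, 0) - f x"

text \<open>The terms coming from \<open>lie_E\<close> only change the coefficients of the
  z-derivatives, subtracting the function from its pairing with \<mu>.\<close>

lemma bracket_eq:
  assumes "f differentiable (at x)" "g differentiable (at x)"
  shows "bracket f g x =
    blinfun_apply (fst x) (br (grad f x) (grad g x)) + leg f x * D g x (0, 1) - leg g x * D f x (0, 1)"
proof -
  have "D h x (lie_E x) = - D h x (0, 1)" if "h differentiable (at x)" for h :: "'g dual \<times> real \<Rightarrow> real"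
    using linear_neg[OF linear_frechet_derivative[OF that], of "(0, 1)"]
    by (cases x) (simp add: lie_E_def)
  then show ?thesis
    using assms
    by (simp add: induced_bracket_def Lambda_differential differential_apply leg_def algebra_simps)
qed

text \<open>The dual basis reduces the pairing to sums of products of real-valued functions, to
  which \<open>smooth_mult\<close> applies.\<close>

lemma smooth_grad_pairing:
  assumes "smooth f" "smooth g"
  shows "smooth (\<lambda>x. blinfun_apply (fst x) (br (grad f x) (grad g x)))"
proof -
  have "blinfun_apply (fst x) (br (grad f x) (grad g x)) =
      (\<Sum>e\<in>E. \<Sum>e'\<in>E. D f x (\<epsilon> e, 0) * D g x (\<epsilon> e', 0) * blinfun_apply (fst x) (br e e'))" for x
    unfolding grad_def
    by (simp add: bounded_bilinear.sum_left[OF bounded_bilinear_br]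
      bounded_bilinear.sum_right[OF bounded_bilinear_br] br_simps
      blinfun.sum_right blinfun.scaleR_right sum_distrib_left mult_ac) (rule sum.swap)
  then show ?thesis
    by (simp add: smooth_sum smooth_mult smooth_D smooth_apply_fst assms)
qed

lemma smooth_leg:
  assumes "smooth f" shows "smooth (leg f)"
proof -
  have "leg f = (\<lambda>x. (\<Sum>e\<in>E. D f x (\<epsilon> e, 0) * blinfun_apply (fst x) e) - f x)"
  proof
    fix x
    have "leg f x = blinfun_apply (fst x) (grad f x) - f x"
      by (simp add: leg_def apply_grad smooth_differentiable assms)
    then show "leg f x = (\<Sum>e\<in>E. D f x (\<epsilon> e, 0) * blinfun_apply (fst x) e) - f x"
      by (simp add: grad_def blinfun.sum_right blinfun.scaleR_right)
  qed
  then show ?thesis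
    by (simp add: smooth_diff smooth_sum smooth_mult smooth_D smooth_apply_fst assms)
qed

lemma smooth_bracket:
  assumes f: "smooth f" and g: "smooth g" shows "smooth (bracket f g)"
proof -
  have "bracket f g = (\<lambda>x. blinfun_apply (fst x) (br (grad f x) (grad g x)) + leg f x * D g x (0, 1) - leg g x * D f x (0, 1))"
    by (intro ext bracket_eq smooth_differentiable f g)
  then show ?thesis
    by (simp add: smooth_diff smooth_add smooth_mult smooth_leg smooth_grad_pairing smooth_D f g)
qed

text \<open>\<open>ham h\<close> is the contact Hamiltonian vector field of \<open>h\<close>, and \<open>leg\<close> is the Legendre-type
  expression \<open>\<langle>\<mu>, \<delta>f/\<delta>\<mu>\<rangle> - f\<close>.\<close>

definition ham :: "('g dual \<times> real \<Rightarrow> real) \<Rightarrow> 'g dual \<times> real \<Rightarrow> 'g dual \<times> real" where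
  "ham h x = (Blinfun (\<lambda>\<xi>. blinfun_apply (fst x) (br \<xi> (grad h x))) + D h x (0, 1) *\<^sub>R fst x, - leg h x)"

lemma fst_ham_apply: "blinfun_apply (fst (ham h x)) \<xi> = blinfun_apply (fst x) (br \<xi> (grad h x)) + D h x (0, 1) * blinfun_apply (fst x) \<xi>"
  by (simp add: ham_def blinfun.add_left blinfun.scaleR_left bounded_linear_Blinfun_apply
    bounded_linear_compose[OF blinfun.bounded_linear_right bounded_linear_br])

text \<open>Stated for any linear \<open>L\<close>, since it is applied both to \<open>D f x\<close>
  and to second derivatives such as \<open>hess f x v\<close>.\<close>

lemma linear_ham:
  fixes L :: "'g dual \<times> real \<Rightarrow> real"
  assumes "linear L"
    and \<xi>: "\<And>\<nu> :: 'g dual. L (\<nu>, 0) = blinfun_apply \<nu> \<xi>"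
  shows "L (ham h x) = blinfun_apply (fst x) (br \<xi> (grad h x)) + D h x (0, 1) * blinfun_apply (fst x) \<xi> - leg h x * L (0, 1)"
proof -
  have "ham h x = (fst (ham h x), 0) - leg h x *\<^sub>R (0, 1)"
    by (simp add: ham_def)
  then have "L (ham h x) = L ((fst (ham h x), 0) - leg h x *\<^sub>R (0, 1))"
    by (rule arg_cong)
  also have "\<dots> = L (fst (ham h x), 0) - leg h x * L (0, 1)"
    by (simp only: linear_diff[OF assms(1)] linear_scale[OF assms(1)] real_scaleR_def)
  finally show ?thesis by (simp add: \<xi> fst_ham_apply)
qed

text \<open>Exhibits the bracket as a first-order differential operator in \<open>f\<close>, the
  form used for nested brackets, linearity and supports.\<close>

lemma bracket_ham:
  assumes "f differentiable (at x)" "h differentiable (at x)"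
  shows "bracket f h x = D f x (ham h x) - f x * D h x (0, 1)"
  unfolding linear_ham[OF linear_frechet_derivative[OF assms(1)] apply_grad[OF assms(1), symmetric]]
    bracket_eq[OF assms] apply_grad[OF assms(1)]
  by (simp add: leg_def algebra_simps)

lemma bracket_skew:
  assumes "f differentiable (at x)" "g differentiable (at x)"
  shows "bracket f g x = - bracket g f x"
  using assms br_skew[of "grad f x" "grad g x"] by (simp add: bracket_eq blinfun.minus_right)

abbreviation hess :: "('g dual \<times> real \<Rightarrow> real) \<Rightarrow> 'g dual \<times> real \<Rightarrow> 'g dual \<times> real \<Rightarrow> 'g dual \<times> real \<Rightarrow> real" where
  "hess f x v w \<equiv> D (\<lambda>y. D f y w) x v"

text \<open>In \<open>hess f x v w\<close> the outer derivative is along \<open>v\<close> and the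
  inner one along \<open>w\<close>. Linearity in the inner direction comes from exchanging the
  two.\<close>

lemma linear_hess:
  assumes "smooth f" shows "linear (hess f x v)"
proof -
  have "hess f x v = D (\<lambda>y. D f y v) x"
    using second_derivative_symmetric[OF assms] by blast
  then show ?thesis
    by (simp add: linear_frechet_derivative smooth_differentiable smooth_D assms)
qed

definition grad' :: "('g dual \<times> real \<Rightarrow> real) \<Rightarrow> 'g dual \<times> real \<Rightarrow> 'g dual \<times> real \<Rightarrow> 'g" where
  "grad' f x v = (\<Sum>e\<in>E. hess f x v (\<epsilon> e, 0) *\<^sub>R e)"

lemma apply_grad':
  assumes "smooth f" shows "blinfun_apply \<nu> (grad' f x v) = hess f x v (\<nu>, 0)"
  unfolding grad'_def by (rule linear_dual_eq[OF linear_fst_slice[OF linear_hess[OF assms]]])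

lemma grad_has_derivative:
  assumes "smooth f" shows "(grad f has_derivative grad' f x) (at x)"
  unfolding grad_def[abs_def] grad'_def[abs_def]
  by (intro has_derivative_sum has_derivative_scaleR_left smooth_has_derivative smooth_D assms)

text \<open>As for a Legendre transform, varying \<mu> in the pairing cancels the derivative of
  \<open>f\<close> along \<mu>; of the first-order terms only the one along z survives.\<close>

lemma leg_has_derivative:
  assumes f: "smooth f"
  shows "(leg f has_derivative (\<lambda>v. hess f x v (fst x, 0) - snd v * D f x (0, 1))) (at x)"
proof -
  have fd: "f differentiable (at y)" for y by (rule smooth_differentiable[OF f])
  have "leg f = (\<lambda>y. blinfun_apply (fst y) (grad f y) - f y)"
    by (simp add: leg_def apply_grad fd fun_eq_iff)
  moreover have "((\<lambda>y. blinfun_apply (fst y) (grad f y) - f y) has_derivative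
      (\<lambda>v. blinfun_apply (fst x) (grad' f x v) + blinfun_apply (fst v) (grad f x) - D f x v)) (at x)"
    by (intro has_derivative_diff blinfun.FDERIV has_derivative_fst has_derivative_ident
      grad_has_derivative smooth_has_derivative f)
  moreover have "blinfun_apply (fst x) (grad' f x v) + blinfun_apply (fst v) (grad f x) - D f x v
      = hess f x v (fst x, 0) - snd v * D f x (0, 1)" for v
  proof -
    have "v = (fst v, 0) + snd v *\<^sub>R (0, 1)" by simp
    then have "D f x v = D f x ((fst v, 0) + snd v *\<^sub>R (0, 1))" by (rule arg_cong)
    also have "\<dots> = D f x (fst v, 0) + snd v * D f x (0, 1)"
      by (simp only: linear_add[OF linear_frechet_derivative[OF fd]]
        linear_scale[OF linear_frechet_derivative[OF fd]] real_scaleR_def)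
    finally show ?thesis by (simp add: apply_grad fd apply_grad' f)
  qed
  ultimately show ?thesis by simp
qed

text \<open>The product rule multiplies the second derivatives of \<open>f\<close> by the components
  of \<open>ham g x\<close>, and those of \<open>g\<close> by the negated components of
  \<open>ham f x\<close>, so \<open>linear_ham\<close> collects them. The two terms with
  \<open>snd v\<close> cancel, and the explicit \<mu> contributes the remaining pairing.\<close>

lemma D_bracket:
  assumes f: "smooth f" and g: "smooth g"
  shows "D (bracket f g) x v =
    blinfun_apply (fst v) (br (grad f x) (grad g x)) + hess f x v (ham g x) - hess g x v (ham f x)"
proof -
  have fd: "f differentiable (at y)" and gd: "g differentiable (at y)" for y
    by (intro smooth_differentiable f g)+
  have "bracket f g = (\<lambda>x. blinfun_apply (fst x) (br (grad f x) (grad g x)) + leg f x * D g x (0, 1) - leg g x * D f x (0, 1))"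
    by (intro ext bracket_eq fd gd)
  moreover have "((\<lambda>x. blinfun_apply (fst x) (br (grad f x) (grad g x)) + leg f x * D g x (0, 1) - leg g x * D f x (0, 1))
    has_derivative (\<lambda>v.
      blinfun_apply (fst x) (br (grad f x) (grad' g x v) + br (grad' f x v) (grad g x)) + blinfun_apply (fst v) (br (grad f x) (grad g x))
      + (leg f x * hess g x v (0, 1) + (hess f x v (fst x, 0) - snd v * D f x (0, 1)) * D g x (0, 1))
      - (leg g x * hess f x v (0, 1) + (hess g x v (fst x, 0) - snd v * D g x (0, 1)) * D f x (0, 1)))) (at x)"
    by (intro has_derivative_diff has_derivative_add has_derivative_mult blinfun.FDERIV
      bounded_bilinear.FDERIV[OF bounded_bilinear_br] has_derivative_fst has_derivative_ident
      grad_has_derivative leg_has_derivative smooth_has_derivative smooth_D f g)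
  ultimately have "D (bracket f g) x v =
      blinfun_apply (fst x) (br (grad f x) (grad' g x v) + br (grad' f x v) (grad g x)) + blinfun_apply (fst v) (br (grad f x) (grad g x))
      + (leg f x * hess g x v (0, 1) + (hess f x v (fst x, 0) - snd v * D f x (0, 1)) * D g x (0, 1))
      - (leg g x * hess f x v (0, 1) + (hess g x v (fst x, 0) - snd v * D g x (0, 1)) * D f x (0, 1))"
    by (simp add: D_eqI)
  moreover have "hess f x v (ham g x) = blinfun_apply (fst x) (br (grad' f x v) (grad g x))
      + D g x (0, 1) * hess f x v (fst x, 0) - leg g x * hess f x v (0, 1)"
    by (subst linear_ham[OF linear_hess[OF f] apply_grad'[OF f, symmetric]]) (simp add: apply_grad' f)
  moreover have "hess g x v (ham f x) = blinfun_apply (fst x) (br (grad' g x v) (grad f x))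
      + D f x (0, 1) * hess g x v (fst x, 0) - leg f x * hess g x v (0, 1)"
    by (subst linear_ham[OF linear_hess[OF g] apply_grad'[OF g, symmetric]]) (simp add: apply_grad' g)
  ultimately show ?thesis
    using br_skew[of "grad f x" "grad' g x v"]
    by (simp add: blinfun.add_right blinfun.diff_right blinfun.minus_right algebra_simps)
qed

lemma bracket_jacobi:
  assumes f: "smooth f" and g: "smooth g" and h: "smooth h"
  shows "bracket (bracket f g) h x + bracket (bracket g h) f x + bracket (bracket h f) g x = 0"
proof -
  \<comment> \<open>The multiple of \<mu> in \<open>ham h x\<close> cancels the Lie bracket part of
    \<open>bracket f g x * D h x (0, 1)\<close>. The remaining products of \<open>leg\<close> with
    z-derivatives sum cyclically to 0.\<close>
  have step: "bracket (bracket f g) h x = blinfun_apply (fst x) (br (br (grad f x) (grad g x)) (grad h x))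
      - (leg f x * D g x (0, 1) - leg g x * D f x (0, 1)) * D h x (0, 1)
      + hess f x (ham h x) (ham g x) - hess g x (ham h x) (ham f x)"
    if "smooth f" "smooth g" "smooth h" for f g h
    using that
    by (simp add: bracket_ham[of "bracket f g"] smooth_differentiable smooth_bracket D_bracket
      fst_ham_apply bracket_eq[of f x g] algebra_simps)
  have jac: "blinfun_apply (fst x) (br (br (grad f x) (grad g x)) (grad h x)) + blinfun_apply (fst x) (br (br (grad g x) (grad h x)) (grad f x))
      + blinfun_apply (fst x) (br (br (grad h x) (grad f x)) (grad g x)) = 0"
    using br_jacobi[of "grad f x" "grad g x" "grad h x"] by (metis blinfun.add_right blinfun.zero_right)
  show ?thesis
    \<comment> \<open>Each function contributes two Hessian terms with opposite signs and exchanged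
      directions, which cancel by symmetry.\<close>
    unfolding step[OF f g h] step[OF g h f] step[OF h f g]
    using jac second_derivative_symmetric[OF f, of "ham g x" x "ham h x"]
      second_derivative_symmetric[OF g, of "ham h x" x "ham f x"]
      second_derivative_symmetric[OF h, of "ham f x" x "ham g x"]
    by (simp add: algebra_simps)
qed

text \<open>The complement of the closed support is open, so \<open>f\<close> and \<open>D f\<close>
  both vanish there, and \<open>bracket_ham\<close> involves only these two.\<close>

lemma supp_bracket:
  assumes f: "smooth f" and g: "smooth g"
  shows "supp (bracket f g) \<subseteq> supp f"
proof -
  have "bracket f g x = 0" if x: "x \<notin> supp f" for x
  proof -
    have o: "open (- supp f)" by (simp add: supp_def open_Compl)
    have z: "f y = 0" if "y \<in> - supp f" for y
      using that closure_subset[of "support_on UNIV f"] by (auto simp: supp_def support_on_def)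
    have "D f x = D (\<lambda>y. 0) x"
      by (rule frechet_derivative_transform_within_open[OF _ o]) (use x z f in \<open>auto intro: smooth_differentiable\<close>)
    then show ?thesis
      using x z by (simp add: bracket_ham smooth_differentiable f g)
  qed
  then have "support_on UNIV (bracket f g) \<subseteq> supp f" by (auto simp: support_on_def)
  then show ?thesis
    unfolding supp_def[of "bracket f g"] by (rule closure_minimal) (simp add: supp_def)
qed

lemma jacobi_bracket_bracket: "jacobi_bracket bracket"
proof -
  have skew: "bracket f g = (\<lambda>x. - bracket g f x)" if "smooth f" "smooth g" for f g
    using that by (intro ext bracket_skew smooth_differentiable)
  have lin: "bracket (\<lambda>x. a * f x + b * g x) h = (\<lambda>x. a * bracket f h x + b * bracket g h x)"
    if "smooth f" "smooth g" "smooth h" for a b f g h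
  proof
    fix x
    have s: "smooth (\<lambda>x. a * f x + b * g x)"
      by (intro smooth_add smooth_mult smooth_const that)
    have "D (\<lambda>x. a * f x + b * g x) x = (\<lambda>v. a * D f x v + b * D g x v)"
      by (intro D_eqI has_derivative_add has_derivative_mult_right smooth_has_derivative that)
    then show "bracket (\<lambda>x. a * f x + b * g x) h x = a * bracket f h x + b * bracket g h x"
      using that s by (simp add: bracket_ham smooth_differentiable algebra_simps)
  qed
  have lin': "bracket h (\<lambda>x. a * f x + b * g x) = (\<lambda>x. a * bracket h f x + b * bracket h g x)"
    if "smooth f" "smooth g" "smooth h" for a b f g h
  proof -
    have s: "smooth (\<lambda>x. a * f x + b * g x)"
      by (intro smooth_add smooth_mult smooth_const that)
    show ?thesis
      \<comment> \<open>Skew symmetry moves the combination into the first argument, where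
        \<open>lin\<close> applies.\<close>
      unfolding skew[OF that(3) s] lin[OF that] skew[OF that(3,1)] skew[OF that(3,2)] by simp
  qed
  have supp': "supp (bracket f g) \<subseteq> supp g" if "smooth f" "smooth g" for f g
  proof -
    have "supp (bracket f g) = supp (bracket g f)"
      unfolding skew[OF that] by (simp add: supp_def support_on_def)
    then show ?thesis using supp_bracket[OF that(2,1)] by simp
  qed
  show ?thesis
    unfolding jacobi_bracket_def
    using smooth_bracket lin lin' skew bracket_jacobi supp_bracket supp' by (meson le_inf_iff)
qed

end

theorem proposition5p6:
  fixes G :: "('a::{t2_space,second_countable_topology}) monoid"
    and A :: "('a set \<times> ('a \<Rightarrow> 'e::real_normed_vector)) set"
    and br :: "'g::real_normed_vector \<Rightarrow> 'g \<Rightarrow> 'g"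
  assumes "lie_group G A"
    and "fin_dim (UNIV :: 'g set)"
    and "is_lie_algebra_of br G A"
  shows "(\<forall>f g :: 'g dual \<times> real \<Rightarrow> real. smooth f \<longrightarrow> smooth g \<longrightarrow> (\<forall>\<mu> z.
            lie_Lambda br (\<mu>, z) (differential f (\<mu>, z)) (differential g (\<mu>, z)) =
              blinfun_apply \<mu> (br (partial_mu f \<mu> z) (partial_mu g \<mu> z))
              + blinfun_apply \<mu> (partial_mu f \<mu> z) * partial_z g \<mu> z
              - blinfun_apply \<mu> (partial_mu g \<mu> z) * partial_z f \<mu> z)) \<and>
         jacobi_structure (lie_Lambda br) lie_E \<and>
         jacobi_bracket (induced_bracket (lie_Lambda br) lie_E) \<and>
         (\<forall>f g :: 'g dual \<times> real \<Rightarrow> real. smooth f \<longrightarrow> smooth g \<longrightarrow> (\<forall>\<mu> z.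
            induced_bracket (lie_Lambda br) lie_E f g (\<mu>, z) =
              lie_Lambda br (\<mu>, z) (differential f (\<mu>, z)) (differential g (\<mu>, z))
              - f (\<mu>, z) * partial_z g \<mu> z + g (\<mu>, z) * partial_z f \<mu> z))"
proof -
  obtain E :: "'g set" and \<epsilon> where "dual_basis E \<epsilon>"
    by (rule fin_dim_dual_basis[OF assms(2)])
  then interpret lie_algebra_basis E \<epsilon> br
    by (intro lie_algebra_basis.intro lie_algebra_basis_axioms.intro lie_algebra_of_laws[OF assms(3)])
  show ?thesis
  proof (intro conjI allI impI)
    fix f g :: "'g dual \<times> real \<Rightarrow> real" and \<mu> z
    assume "smooth f" "smooth g"
    then have fg: "f differentiable (at (\<mu>, z))" "g differentiable (at (\<mu>, z))"
      by (auto intro: smooth_differentiable)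
    show "lie_Lambda br (\<mu>, z) (differential f (\<mu>, z)) (differential g (\<mu>, z)) =
              blinfun_apply \<mu> (br (partial_mu f \<mu> z) (partial_mu g \<mu> z))
              + blinfun_apply \<mu> (partial_mu f \<mu> z) * partial_z g \<mu> z
              - blinfun_apply \<mu> (partial_mu g \<mu> z) * partial_z f \<mu> z"
      using fg by (simp add: Lambda_differential partial_mu_eq partial_z_eq apply_grad)
    show "induced_bracket (lie_Lambda br) lie_E f g (\<mu>, z) =
              lie_Lambda br (\<mu>, z) (differential f (\<mu>, z)) (differential g (\<mu>, z))
              - f (\<mu>, z) * partial_z g \<mu> z + g (\<mu>, z) * partial_z f \<mu> z"
      using fg by (simp add: bracket_eq Lambda_differential partial_z_eq leg_def algebra_simps)
  qed (rule jacobi_structure_Lambda jacobi_bracket_bracket)+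
qed

end
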